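(* Let $k\ge1$ be an integer and $f\in C_c^k(\mathbb{R}^n)$. Then, for every $x\in\mathbb{R}^n$, $$\lim_{r\to0^+}r^{-k}\operatorname{osc}_k(f;B(x,r))=\mathfrak C_{n,k}(D^kf(x)).$$ Moreover, there are constants $0<a_{n,k}\le b_{n,k}<\infty$ (depending only on $n,k$) such that $$a_{n,k}|A|_E\le\mathfrak C_{n,k}(A)\le b_{n,k}|A|_E\qquad\text{for all }A\in\operatorname{Sym}^k(\mathbb{R}^n).$$
   Context: $\mathcal P_{k-1}$ is the vector space of polynomials on $\mathbb{R}^n$ of degree at most $k-1$, and $$\operatorname{osc}_k(f;B(x,r)):=\inf_{P\in\mathcal P_{k-1}}\frac1{|B(x,r)|}\int_{B(x,r)}|f(y)-P(y)|\,dy.$$ $\operatorname{Sym}^k(\mathbb{R}^n)$ is the space of symmetric $k$-linear forms on $\mathbb{R}^n$, $|A|_E$ is the Euclidean norm of $A\in\operatorname{Sym}^k(\mathbb{R}^n)$ (the $\ell^2$ norm of its components $A_{i_1\cdots i_k}$), and $A[z^k]:=A[z,\dots,z]$. For $A\in\operatorname{Sym}^k(\mathbb{R}^n)$ put $P_A(z):=\frac1{k!}A[z^k]$ and, with $B_1=B(0,1)$, $$\mathfrak C_{n,k}(A):=\inf_{P\in\mathcal P_{k-1}}\frac1{|B_1|}\int_{B_1}|P_A(z)-P(z)|\,dz.$$ $D^kf(x)\in\operatorname{Sym}^k(\mathbb{R}^n)$ is the form with components $\partial_{i_1}\cdots\partial_{i_k}f(x)$. *)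

theory Defs
  imports "HOL-Analysis.Analysis" "HOL-Library.Multiset"
begin

definition partial_deriv :: "'n \<Rightarrow> (real ^ 'n \<Rightarrow> real) \<Rightarrow> real ^ 'n \<Rightarrow> real" where
  "partial_deriv i f x = deriv (\<lambda>t. f (x + t *\<^sub>R axis i 1)) 0"

text \<open>\<open>iter_partial [i\<^sub>1, \<dots>, i\<^sub>k] f\<close> is \<open>\<partial>\<^sub>i\<^sub>1 \<dots> \<partial>\<^sub>i\<^sub>k f\<close>; the last listed derivative is taken first.\<close>

primrec iter_partial :: "'n list \<Rightarrow> (real ^ 'n \<Rightarrow> real) \<Rightarrow> real ^ 'n \<Rightarrow> real" where
  "iter_partial [] f = f"
| "iter_partial (i # is) f = partial_deriv i (iter_partial is f)"

text \<open>\<open>C\<^sup>k\<close> in the usual recursive form: \<open>f\<close> is Frechet differentiable everywhere and the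
  components of its derivative are \<open>C\<^sup>k\<^sup>-\<^sup>1\<close>.\<close>

primrec Ck_fun :: "nat \<Rightarrow> (real ^ 'n \<Rightarrow> real) \<Rightarrow> bool" where
  "Ck_fun 0 f \<longleftrightarrow> continuous_on UNIV f"
| "Ck_fun (Suc k) f \<longleftrightarrow> (\<forall>x. f differentiable (at x)) \<and> (\<forall>i. Ck_fun k (partial_deriv i f))"

definition Ck_compact_support :: "nat \<Rightarrow> (real ^ 'n \<Rightarrow> real) set" where
  "Ck_compact_support k = {f. Ck_fun k f \<and> compact (closure {x. f x \<noteq> 0})}"

definition polys_upto :: "nat \<Rightarrow> (real ^ 'n \<Rightarrow> real) set" where
  "polys_upto m = {p. \<exists>c :: ('n \<Rightarrow> nat) \<Rightarrow> real. \<forall>x.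
     p x = (\<Sum>\<alpha> | (\<Sum>i\<in>UNIV. \<alpha> i) \<le> m. c \<alpha> * (\<Prod>i\<in>UNIV. (x $ i) ^ \<alpha> i))}"

text \<open>The index sets of the sums in \<open>polys_upto\<close> and in the definitions of forms below are finite.\<close>

lemma finite_multi_indices: "finite {\<alpha> :: 'n::finite \<Rightarrow> nat. (\<Sum>i\<in>UNIV. \<alpha> i) \<le> m}"
proof (rule finite_subset)
  show "{\<alpha> :: 'n \<Rightarrow> nat. (\<Sum>i\<in>UNIV. \<alpha> i) \<le> m} \<subseteq> PiE UNIV (\<lambda>_. {..m})"
  proof
    fix \<alpha> :: "'n \<Rightarrow> nat" assume "\<alpha> \<in> {\<alpha>. (\<Sum>i\<in>UNIV. \<alpha> i) \<le> m}"
    moreover have "\<alpha> i \<le> (\<Sum>i\<in>UNIV. \<alpha> i)" for i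
      by (rule member_le_sum) auto
    ultimately show "\<alpha> \<in> PiE UNIV (\<lambda>_. {..m})"
      by (auto simp: PiE_UNIV_domain intro: le_trans)
  qed
qed (auto intro: finite_PiE)

lemma finite_index_lists: "finite {is :: 'n::finite list. length is = k}"
  using finite_lists_length_eq[of "UNIV :: 'n set" k] by simp

text \<open>Only meant for \<open>k \<ge> 1\<close>: the subtraction \<open>k - 1\<close> is truncated.\<close>

definition osc :: "nat \<Rightarrow> (real ^ 'n \<Rightarrow> real) \<Rightarrow> real ^ 'n \<Rightarrow> real \<Rightarrow> real" where
  "osc k f x r = (INF P\<in>polys_upto (k - 1).
     (1 / measure lebesgue (ball x r)) * (LINT y:ball x r|lebesgue. \<bar>f y - P y\<bar>))"

text \<open>A \<open>k\<close>-linear form is a function on argument lists of length \<open>k\<close>, with the value \<open>0\<close> by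
  convention on lists of any other length.\<close>

definition sym_forms :: "nat \<Rightarrow> ((real ^ 'n) list \<Rightarrow> real) set" where
  "sym_forms k = {A.
     (\<forall>vs j. length vs = k \<longrightarrow> j < k \<longrightarrow> linear (\<lambda>v. A (vs[j := v]))) \<and>
     (\<forall>vs ws. length vs = k \<longrightarrow> mset ws = mset vs \<longrightarrow> A ws = A vs) \<and>
     (\<forall>vs. length vs \<noteq> k \<longrightarrow> A vs = 0)}"

definition form_norm :: "nat \<Rightarrow> ((real ^ 'n) list \<Rightarrow> real) \<Rightarrow> real" where
  "form_norm k A = sqrt (\<Sum>is | length is = k. (A (map (\<lambda>i. axis i 1) is))\<^sup>2)"

definition form_poly :: "nat \<Rightarrow> ((real ^ 'n) list \<Rightarrow> real) \<Rightarrow> real ^ 'n \<Rightarrow> real" where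
  "form_poly k A z = A (replicate k z) / fact k"

definition osc_const :: "nat \<Rightarrow> ((real ^ 'n) list \<Rightarrow> real) \<Rightarrow> real" where
  "osc_const k A = osc k (form_poly k A) 0 1"

definition deriv_form ::
    "nat \<Rightarrow> (real ^ 'n \<Rightarrow> real) \<Rightarrow> real ^ 'n \<Rightarrow> (real ^ 'n) list \<Rightarrow> real" where
  "deriv_form k f x vs = (if length vs = k
     then \<Sum>is | length is = k. iter_partial is f x * (\<Prod>j<k. (vs ! j) $ (is ! j))
     else 0)"

lemma deriv_form_component:
  fixes f :: "real ^ 'n \<Rightarrow> real"
  assumes "length js = k"
  shows "deriv_form k f x (map (\<lambda>i. axis i 1) js) = iter_partial js f x"
proof -
  have *: "(\<Prod>j<k. (map (\<lambda>i. axis i (1::real)) js ! j) $ (is ! j)) = (if is = js then 1 else 0)"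
    if len: "length is = k" for "is" :: "'n list"
  proof (cases "is = js")
    case True
    then show ?thesis using len by (simp add: axis_def)
  next
    case False
    then obtain j where "j < k" "is ! j \<noteq> js ! j"
      using len assms by (metis nth_equalityI)
    then show ?thesis using assms len False
      by (auto simp: axis_def intro!: prod_zero bexI[of _ j])
  qed
  have "deriv_form k f x (map (\<lambda>i. axis i 1) js)
      = (\<Sum>is | length is = k. if is = js then iter_partial is f x else 0)"
    unfolding deriv_form_def using assms
    by (simp del: nth_map prod_zero_iff) (rule sum.cong, auto simp only: mem_Collect_eq *, auto)
  also have "\<dots> = iter_partial js f x"
    using assms by (simp add: sum.delta[OF finite_index_lists])
  finally show ?thesis .
qed

end

theory Submission
  imports Defs
begin

text \<open>Rescaling \<open>ball x r\<close> to the unit ball, Taylor's formula writes \<open>f (x + r y)\<close> as a polynomial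
  in \<open>y\<close> of degree less than \<open>k\<close> plus \<open>r\<^sup>k\<close> times a function that converges uniformly on the unit ball
  to \<open>form_poly k (deriv_form k f x)\<close>; the oscillation ignores the polynomial, is homogeneous, and is
  \<open>1\<close>-Lipschitz in the supremum norm. The upper bound in the comparison takes \<open>P = 0\<close>. For the lower
  bound, the \<open>k\<close>-fold difference along basis vectors recovers each component of \<open>A\<close> from
  \<open>form_poly k A - P\<close>, and it is bounded in \<open>L\<^sup>1\<close>.\<close>

subsection \<open>Polynomials of degree less than a given bound\<close>

text \<open>A strict degree bound makes the case of the zero polynomial, which ends the induction on the
  number of differences, the bound \<open>0\<close>.\<close>

definition polys_below :: "nat \<Rightarrow> (real ^ 'n \<Rightarrow> real) set" where
  "polys_below m = {p. \<exists>c :: ('n \<Rightarrow> nat) \<Rightarrow> real. \<forall>x.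
     p x = (\<Sum>\<alpha> | (\<Sum>i\<in>UNIV. \<alpha> i) < m. c \<alpha> * (\<Prod>i\<in>UNIV. (x $ i) ^ \<alpha> i))}"

lemma polys_upto_eq_polys_below:
  "m \<ge> 1 \<Longrightarrow> polys_upto (m - 1) = (polys_below m :: (real ^ 'n \<Rightarrow> real) set)"
  by (cases m) (simp_all add: polys_upto_def polys_below_def less_Suc_eq_le)

lemma finite_multi_indices_less: "finite {\<alpha> :: 'n::finite \<Rightarrow> nat. (\<Sum>i\<in>UNIV. \<alpha> i) < m}"
  by (rule finite_subset[OF _ finite_multi_indices[of m]]) auto

lemma polys_below_0: "polys_below 0 = {\<lambda>_. 0}"
  by (auto simp: polys_below_def)

lemma zero_in_polys_below: "(\<lambda>_. 0) \<in> polys_below m"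
  unfolding polys_below_def by (auto intro!: exI[of _ "\<lambda>_. 0"])

lemma polys_below_add:
  assumes "p \<in> polys_below m" "q \<in> polys_below m"
  shows "(\<lambda>x. p x + q x) \<in> polys_below m"
proof -
  obtain c d where
    "\<And>x. p x = (\<Sum>\<alpha> | (\<Sum>i\<in>UNIV. \<alpha> i) < m. c \<alpha> * (\<Prod>i\<in>UNIV. (x $ i) ^ \<alpha> i))"
    "\<And>x. q x = (\<Sum>\<alpha> | (\<Sum>i\<in>UNIV. \<alpha> i) < m. d \<alpha> * (\<Prod>i\<in>UNIV. (x $ i) ^ \<alpha> i))"
    using assms unfolding polys_below_def by blast
  then show ?thesis
    unfolding polys_below_def
    by (auto intro!: exI[of _ "\<lambda>\<alpha>. c \<alpha> + d \<alpha>"] simp: distrib_right sum.distrib)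
qed

lemma polys_below_scale:
  assumes "p \<in> polys_below m"
  shows "(\<lambda>x. a * p x) \<in> polys_below m"
proof -
  obtain c where
    "\<And>x. p x = (\<Sum>\<alpha> | (\<Sum>i\<in>UNIV. \<alpha> i) < m. c \<alpha> * (\<Prod>i\<in>UNIV. (x $ i) ^ \<alpha> i))"
    using assms unfolding polys_below_def by blast
  then show ?thesis
    unfolding polys_below_def
    by (auto intro!: exI[of _ "\<lambda>\<alpha>. a * c \<alpha>"] simp: sum_distrib_left mult.assoc)
qed

lemma polys_below_sum:
  "(\<And>s. s \<in> S \<Longrightarrow> p s \<in> polys_below m) \<Longrightarrow> (\<lambda>x. \<Sum>s\<in>S. p s x) \<in> polys_below m"
  by (induction S rule: infinite_finite_induct)
     (auto intro: polys_below_add zero_in_polys_below)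

lemma monomial_in_polys_below:
  assumes "(\<Sum>i\<in>UNIV. \<beta> i) < m"
  shows "(\<lambda>x. \<Prod>i\<in>UNIV. (x $ i) ^ \<beta> i) \<in> polys_below m"
proof -
  have "(\<Prod>i\<in>UNIV. (x $ i) ^ \<beta> i) = (\<Sum>\<alpha> | (\<Sum>i\<in>UNIV. \<alpha> i) < m.
      (if \<alpha> = \<beta> then 1 else 0) * (\<Prod>i\<in>UNIV. (x $ i) ^ \<alpha> i))" for x :: "real ^ 'a"
    using assms by (simp add: if_distrib[of "\<lambda>a. a * _"] sum.delta finite_multi_indices_less cong: if_cong)
  then show ?thesis
    unfolding polys_below_def
    by (intro CollectI exI[of _ "\<lambda>\<alpha>. if \<alpha> = \<beta> then 1 else 0"] allI)
qed

text \<open>In each monomial one exponent goes up by one. Later degree counts build polynomials one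
  coordinate factor at a time by means of this.\<close>

lemma polys_below_mult_coord:
  assumes "p \<in> polys_below m"
  shows "(\<lambda>x. x $ i * p x) \<in> polys_below (Suc m)"
proof -
  obtain c where c:
    "\<And>x. p x = (\<Sum>\<alpha> | (\<Sum>i\<in>UNIV. \<alpha> i) < m. c \<alpha> * (\<Prod>i\<in>UNIV. (x $ i) ^ \<alpha> i))"
    using assms unfolding polys_below_def by blast
  have "x $ i * (\<Prod>j\<in>UNIV. (x $ j) ^ \<alpha> j) = (\<Prod>j\<in>UNIV. (x $ j) ^ (\<alpha>(i := Suc (\<alpha> i))) j)"
    for x :: "real ^ 'a" and \<alpha>
    by (subst (1 2) prod.remove[of _ i]) auto
  moreover have "(\<Sum>j\<in>UNIV. (\<alpha>(i := Suc (\<alpha> i))) j) = Suc (\<Sum>j\<in>UNIV. \<alpha> j)" for \<alpha> :: "'a \<Rightarrow> nat"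
    by (subst (1 2) sum.remove[of _ i]) auto
  ultimately have "(\<lambda>x. x $ i * (\<Prod>j\<in>UNIV. (x $ j) ^ \<alpha> j)) \<in> polys_below (Suc m)"
    if "(\<Sum>j\<in>UNIV. \<alpha> j) < m" for \<alpha>
    using monomial_in_polys_below[of "\<alpha>(i := Suc (\<alpha> i))" "Suc m"] that by simp
  then have "(\<lambda>x. \<Sum>\<alpha> | (\<Sum>i\<in>UNIV. \<alpha> i) < m. c \<alpha> * (x $ i * (\<Prod>j\<in>UNIV. (x $ j) ^ \<alpha> j)))
      \<in> polys_below (Suc m)"
    by (intro polys_below_sum polys_below_scale) auto
  then show ?thesis
    by (simp add: c sum_distrib_left mult.left_commute)
qed

lemma one_in_polys_below: "(\<lambda>_. 1) \<in> polys_below (Suc m)"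
  using monomial_in_polys_below[of "\<lambda>_. 0" "Suc m"] by simp

lemma polys_below_mono: "m \<le> m' \<Longrightarrow> polys_below m \<subseteq> polys_below m'"
proof
  fix p :: "real ^ 'n \<Rightarrow> real" assume "m \<le> m'" "p \<in> polys_below m"
  then obtain c where c:
    "\<And>x. p x = (\<Sum>\<alpha> | (\<Sum>i\<in>UNIV. \<alpha> i) < m. c \<alpha> * (\<Prod>i\<in>UNIV. (x $ i) ^ \<alpha> i))"
    unfolding polys_below_def by blast
  show "p \<in> polys_below m'"
    using \<open>m \<le> m'\<close> unfolding c[abs_def]
    by (intro polys_below_sum polys_below_scale monomial_in_polys_below) auto
qed

lemma polys_below_continuous: "p \<in> polys_below m \<Longrightarrow> continuous_on S p"
proof -
  assume "p \<in> polys_below m"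
  then obtain c where c:
    "p = (\<lambda>x. \<Sum>\<alpha> | (\<Sum>i\<in>UNIV. \<alpha> i) < m. c \<alpha> * (\<Prod>i\<in>UNIV. (x $ i) ^ \<alpha> i))"
    unfolding polys_below_def by blast
  show ?thesis
    unfolding c by (intro continuous_intros)
qed

text \<open>A monomial arises from the constant 1 by multiplications with coordinates. The degree is
  a separate argument of \<open>P\<close>, so that it is counted along with the
  construction.\<close>

lemma monomial_induct:
  fixes \<alpha> :: "'n::finite \<Rightarrow> nat"
  assumes one: "P (\<lambda>_. 1) 0"
    and mult: "\<And>p d i. P p d \<Longrightarrow> P (\<lambda>x :: real ^ 'n. x $ i * p x) (Suc d)"
  shows "P (\<lambda>x. \<Prod>i\<in>UNIV. (x $ i) ^ \<alpha> i) (\<Sum>i\<in>UNIV. \<alpha> i)"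
proof -
  \<comment> \<open>Powers of a single coordinate come first; the induction over the set of
    coordinates then adds one such power at a time.\<close>
  have "P (\<lambda>x. (x $ i) ^ e * p x) (e + d)" if "P p d" for i e p d
    using that by (induction e) (use mult[of _ _ i] in \<open>auto simp: mult.assoc\<close>)
  note * = this
  have "P (\<lambda>x. \<Prod>i\<in>S. (x $ i) ^ \<alpha> i) (\<Sum>i\<in>S. \<alpha> i)" if "finite S" for S
    using that
  proof induction
    case empty
    show ?case by (simp add: one)
  next
    case (insert i S)
    then show ?case using *[OF insert.IH, of i "\<alpha> i"] by simp
  qed
  then show ?thesis by simp
qed

text \<open>The coordinates of \<open>a + r *\<^sub>R x\<close> have degree at most 1 in
  \<open>x\<close>, so the substitution does not raise the degree of a monomial. This makes the
  oscillation compatible with rescaling.\<close>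

lemma polys_below_affine:
  assumes "p \<in> polys_below m"
  shows "(\<lambda>x. p (a + r *\<^sub>R x)) \<in> polys_below m"
proof -
  obtain c where c:
    "\<And>x. p x = (\<Sum>\<alpha> | (\<Sum>i\<in>UNIV. \<alpha> i) < m. c \<alpha> * (\<Prod>i\<in>UNIV. (x $ i) ^ \<alpha> i))"
    using assms unfolding polys_below_def by blast
  have step: "(\<lambda>x. (a + r *\<^sub>R x) $ i * p (a + r *\<^sub>R x)) \<in> polys_below (Suc (Suc d))"
    if p: "(\<lambda>x. p (a + r *\<^sub>R x)) \<in> polys_below (Suc d)" for p :: "real ^ 'a \<Rightarrow> real" and d i
  proof -
    have "(\<lambda>x. a $ i * p (a + r *\<^sub>R x) + r * (x $ i * p (a + r *\<^sub>R x))) \<in> polys_below (Suc (Suc d))"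
      using p polys_below_mono[of "Suc d" "Suc (Suc d)"]
      by (intro polys_below_add polys_below_scale polys_below_mult_coord) auto
    then show ?thesis
      by (simp add: distrib_right mult.assoc)
  qed
  have "(\<lambda>x. \<Prod>i\<in>UNIV. ((a + r *\<^sub>R x) $ i) ^ \<alpha> i) \<in> polys_below (Suc (\<Sum>i\<in>UNIV. \<alpha> i))" for \<alpha>
    using monomial_induct[of "\<lambda>p d. (\<lambda>x. p (a + r *\<^sub>R x)) \<in> polys_below (Suc d)" \<alpha>]
    by (simp add: one_in_polys_below step del: vector_add_component vector_scaleR_component)
  then have "(\<lambda>x. \<Prod>i\<in>UNIV. ((a + r *\<^sub>R x) $ i) ^ \<alpha> i) \<in> polys_below m"
    if "(\<Sum>i\<in>UNIV. \<alpha> i) < m" for \<alpha>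
    using that polys_below_mono[of "Suc (\<Sum>i\<in>UNIV. \<alpha> i)" m] by (meson Suc_leI subsetD)
  then show ?thesis
    unfolding c by (intro polys_below_sum polys_below_scale) auto
qed

text \<open>Product rule: the difference of \<open>x $ i * p x\<close> is \<open>x $ i\<close> times
  the difference of \<open>p\<close> plus \<open>h $ i * p (x + h)\<close>, and inductively both
  terms have smaller degree than the product.\<close>

lemma polys_below_difference:
  assumes "p \<in> polys_below (Suc m)"
  shows "(\<lambda>x. p (x + h) - p x) \<in> polys_below m"
proof -
  obtain c where c:
    "\<And>x. p x = (\<Sum>\<alpha> | (\<Sum>i\<in>UNIV. \<alpha> i) < Suc m. c \<alpha> * (\<Prod>i\<in>UNIV. (x $ i) ^ \<alpha> i))"
    using assms unfolding polys_below_def by blast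
  \<comment> \<open>The product rule also produces a shift of \<open>p\<close> itself, so the
    induction carries the degree bound of \<open>p\<close> together with that of its
    difference.\<close>
  define Q where "Q = (\<lambda>(p :: real ^ 'a \<Rightarrow> real) d.
    p \<in> polys_below (Suc d) \<and> (\<lambda>x. p (x + h) - p x) \<in> polys_below d)"
  have "Q (\<lambda>x. x $ i * p x) (Suc d)" if p: "Q p d" for p d i
  proof -
    have "(\<lambda>x. p (x + h)) \<in> polys_below (Suc d)"
      using polys_below_affine[of p "Suc d" h 1] p by (simp add: Q_def add.commute)
    then have "(\<lambda>x. x $ i * (p (x + h) - p x) + h $ i * p (x + h)) \<in> polys_below (Suc d)"
      using p by (intro polys_below_add polys_below_scale polys_below_mult_coord) (auto simp: Q_def)
    moreover have "(\<lambda>x. x $ i * (p (x + h) - p x) + h $ i * p (x + h)) =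
        (\<lambda>x. (x + h) $ i * p (x + h) - x $ i * p x)"
      by (simp add: fun_eq_iff algebra_simps)
    ultimately show ?thesis
      using p polys_below_mult_coord[of p "Suc d" i] by (simp add: Q_def)
  qed
  moreover have "Q (\<lambda>_. 1) 0"
    by (simp add: Q_def one_in_polys_below zero_in_polys_below)
  ultimately have Q: "Q (\<lambda>x. \<Prod>i\<in>UNIV. (x $ i) ^ \<alpha> i) (\<Sum>i\<in>UNIV. \<alpha> i)" for \<alpha>
    using monomial_induct[of Q \<alpha>] by blast
  have "(\<lambda>x. (\<Prod>i\<in>UNIV. ((x + h) $ i) ^ \<alpha> i) - (\<Prod>i\<in>UNIV. (x $ i) ^ \<alpha> i)) \<in> polys_below m"
    if "(\<Sum>i\<in>UNIV. \<alpha> i) < Suc m" for \<alpha>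
    using Q[of \<alpha>] polys_below_mono[of "\<Sum>i\<in>UNIV. \<alpha> i" m] that by (auto simp: Q_def)
  then have "(\<lambda>x. \<Sum>\<alpha> | (\<Sum>i\<in>UNIV. \<alpha> i) < Suc m.
      c \<alpha> * ((\<Prod>i\<in>UNIV. ((x + h) $ i) ^ \<alpha> i) - (\<Prod>i\<in>UNIV. (x $ i) ^ \<alpha> i))) \<in> polys_below m"
    by (intro polys_below_sum polys_below_scale) auto
  then show ?thesis
    unfolding c by (simp add: right_diff_distrib sum_subtractf)
qed

subsection \<open>Iterated differences\<close>

text \<open>The mixed finite difference with steps \<open>hs\<close>: an alternating sum of the
  values of \<open>f\<close> at \<open>x\<close> plus partial sums of the steps, one for each subset
  of positions in \<open>hs\<close>.\<close>

primrec iter_diff :: "'a::ab_group_add list \<Rightarrow> ('a \<Rightarrow> real) \<Rightarrow> 'a \<Rightarrow> real" where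
  "iter_diff [] f = f"
| "iter_diff (h # hs) f = iter_diff hs (\<lambda>x. f (x + h) - f x)"

lemma iter_diff_linear:
  "iter_diff hs (\<lambda>x. a * f x + b * g x) x = a * iter_diff hs f x + b * iter_diff hs g x"
proof (induction hs arbitrary: f g x)
  case (Cons h hs)
  have "(\<lambda>x. a * f (x + h) + b * g (x + h) - (a * f x + b * g x)) =
      (\<lambda>x. a * (f (x + h) - f x) + b * (g (x + h) - g x))"
    by (simp add: fun_eq_iff algebra_simps)
  then show ?case
    using Cons.IH by simp
qed simp

lemma iter_diff_poly_eq_0:
  "p \<in> polys_below (length hs) \<Longrightarrow> iter_diff hs p x = 0"
  by (induction hs arbitrary: p) (auto simp: polys_below_0 dest: polys_below_difference)

lemma continuous_on_shift:
  fixes f :: "'a::real_normed_vector \<Rightarrow> 'b::topological_space"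
  shows "continuous_on UNIV f \<Longrightarrow> continuous_on UNIV (\<lambda>x. f (x + h))"
  by (rule continuous_on_compose2[of UNIV f UNIV]) (auto intro!: continuous_intros)

subsection \<open>Symmetric forms\<close>

text \<open>The first slot stands for all of them, since symmetry brings any argument to the
  front.\<close>

lemma sym_form_linear:
  assumes "A \<in> sym_forms k" "Suc (length vs) = k"
  shows "linear (\<lambda>v. A (v # vs))"
proof -
  have "linear (\<lambda>v. A ((0 # vs)[0 := v]))"
    using assms by (auto simp: sym_forms_def simp del: list_update.simps)
  then show ?thesis by simp
qed

text \<open>Lists with the same multiset have the same length, and on lists of a wrong length both
  values are the default 0.\<close>

lemma sym_form_mset:
  assumes "A \<in> sym_forms k" "mset ws = mset vs"
  shows "A ws = A vs"
proof (cases "length vs = k")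
  case True
  then show ?thesis
    using assms unfolding sym_forms_def by blast
next
  case False
  then have "length ws \<noteq> k"
    using mset_eq_length[OF assms(2)] by simp
  then show ?thesis
    using False assms(1) unfolding sym_forms_def by simp
qed

text \<open>Supplies the form of lower order for the induction in \<open>iter_diff_sym_form\<close>,
  where a difference in direction \<open>h\<close> fills one slot with \<open>h\<close>.\<close>

lemma sym_form_Cons:
  assumes "A \<in> sym_forms (Suc k)"
  shows "(\<lambda>vs. A (h # vs)) \<in> sym_forms k"
proof -
  have "linear (\<lambda>v. A (h # vs[j := v]))" if "length vs = k" "j < k" for vs j
  proof -
    have "linear (\<lambda>v. A ((h # vs)[Suc j := v]))"
      using assms that by (auto simp: sym_forms_def simp del: list_update.simps)
    then show ?thesis by simp
  qed
  moreover have "A (h # ws) = A (h # vs)" if "mset ws = mset vs" for vs ws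
    using sym_form_mset[OF assms, of "h # ws" "h # vs"] that by simp
  moreover have "A (h # vs) = 0" if "length vs \<noteq> k" for vs
    using assms that unfolding sym_forms_def by simp
  ultimately show ?thesis
    unfolding sym_forms_def by blast
qed

lemma linear_expansion:
  fixes L :: "real ^ 'n \<Rightarrow> 'b::real_vector"
  assumes "linear L"
  shows "L z = (\<Sum>i\<in>UNIV. z $ i *\<^sub>R L (axis i 1))"
proof -
  have "L z = L (\<Sum>i\<in>UNIV. z $ i *\<^sub>R axis i 1)"
    using basis_expansion[of z] by (simp add: scalar_mult_eq_scaleR)
  then show ?thesis
    using assms by (simp add: linear_sum linear_cmul)
qed

text \<open>One copy of \<open>z\<close> is expanded in the basis, and the basis vector is stored
  behind the remaining copies. There it joins the fixed arguments \<open>ws\<close>, the shape that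
  inductions on \<open>j\<close> need.\<close>

lemma sym_form_expand:
  fixes A :: "(real ^ 'n) list \<Rightarrow> real"
  assumes "A \<in> sym_forms k" "Suc j + length ws = k"
  shows "A (replicate (Suc j) z @ ws) = (\<Sum>i\<in>UNIV. z $ i * A (replicate j z @ axis i 1 # ws))"
proof -
  have "A (replicate (Suc j) z @ ws) = A (z # (replicate j z @ ws))"
    by simp
  also have "\<dots> = (\<Sum>i\<in>UNIV. z $ i * A (axis i 1 # (replicate j z @ ws)))"
    using linear_expansion[OF sym_form_linear[OF assms(1), of "replicate j z @ ws"], of z] assms(2)
    by simp
  also have "\<dots> = (\<Sum>i\<in>UNIV. z $ i * A (replicate j z @ axis i 1 # ws))"
    by (intro sum.cong arg_cong2[where f = "(*)"] sym_form_mset[OF assms(1)]) auto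
  finally show ?thesis .
qed

text \<open>By \<open>sym_form_expand\<close> each copy of \<open>z\<close> contributes one
  coordinate factor, while \<open>ws\<close> grows during the induction.\<close>

lemma sym_form_in_polys_below:
  assumes "A \<in> sym_forms k" "j + length ws = k"
  shows "(\<lambda>z. A (replicate j z @ ws)) \<in> polys_below (Suc j)"
  using assms(2)
proof (induction j arbitrary: ws)
  case 0
  then show ?case
    using polys_below_scale[OF one_in_polys_below, of "A ws"] by simp
next
  case (Suc j)
  have "(\<lambda>z. \<Sum>i\<in>UNIV. z $ i * A (replicate j z @ axis i 1 # ws)) \<in> polys_below (Suc (Suc j))"
    using Suc by (intro polys_below_sum polys_below_mult_coord) auto
  then show ?case
    using sym_form_expand[OF assms(1) Suc.prems] by (simp del: replicate.simps)
qed

text \<open>Expanding a copy of \<open>z\<close> gives \<open>CARD('n)\<close> terms with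
  coordinates of absolute value at most 1; when all copies are expanded, only components of
  \<open>A\<close> remain.\<close>

lemma sym_form_bound:
  fixes A :: "(real ^ 'n) list \<Rightarrow> real"
  assumes "A \<in> sym_forms k" and M: "\<And>is. length is = k \<Longrightarrow> \<bar>A (map (\<lambda>i. axis i 1) is)\<bar> \<le> M"
    and "norm z \<le> 1" "j + length is = k"
  shows "\<bar>A (replicate j z @ map (\<lambda>i. axis i 1) is)\<bar> \<le> real CARD('n) ^ j * M"
  using assms(4)
proof (induction j arbitrary: "is")
  case 0
  then show ?case using M by simp
next
  case (Suc j)
  have "\<bar>A (replicate (Suc j) z @ map (\<lambda>i. axis i 1) is)\<bar>
      \<le> (\<Sum>i\<in>UNIV. \<bar>z $ i * A (replicate j z @ map (\<lambda>i. axis i 1) (i # is))\<bar>)"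
    using sym_form_expand[OF assms(1), of j "map (\<lambda>i. axis i 1) is" z] Suc.prems
    by (simp del: replicate.simps)
  also have "\<dots> \<le> (\<Sum>i\<in>(UNIV :: 'n set). 1 * (real CARD('n) ^ j * M))"
    unfolding abs_mult
  proof (intro sum_mono mult_mono)
    show "\<bar>z $ i\<bar> \<le> 1" for i
      using component_le_norm_cart[of z i] assms(3) by simp
    show "\<bar>A (replicate j z @ map (\<lambda>i. axis i 1) (i # is))\<bar> \<le> real CARD('n) ^ j * M" for i
      using Suc by (intro Suc.IH) auto
  qed auto
  finally show ?case by simp
qed

text \<open>An argument that has released its factor \<open>c\<close> moves into \<open>ws\<close>,
  so that the next scaled one stands in front.\<close>

lemma sym_form_scale:
  assumes "A \<in> sym_forms k" "length us + length ws = k"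
  shows "A (map (\<lambda>u. c *\<^sub>R u) us @ ws) = c ^ length us * A (us @ ws)"
  using assms(2)
proof (induction us arbitrary: ws)
  case (Cons u us)
  have "A (map ((*\<^sub>R) c) (u # us) @ ws) = c * A (u # (map ((*\<^sub>R) c) us @ ws))"
    using linear_cmul[OF sym_form_linear[OF assms(1), of "map ((*\<^sub>R) c) us @ ws"]] Cons.prems by simp
  also have "A (u # (map ((*\<^sub>R) c) us @ ws)) = A (map ((*\<^sub>R) c) us @ u # ws)"
    by (rule sym_form_mset[OF assms(1)]) simp
  also have "\<dots> = c ^ length us * A (us @ u # ws)"
    using Cons by simp
  also have "A (us @ u # ws) = A (u # us @ ws)"
    by (rule sym_form_mset[OF assms(1)]) simp
  finally show ?case by simp
qed simp

text \<open>By symmetry only the number of slots holding \<open>z\<close> matters, so splitting one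
  argument \<open>z + h\<close> leads to Pascal's rule.\<close>

lemma sym_form_binomial:
  assumes "A \<in> sym_forms k" "m + length ws = k"
  shows "A (replicate m (z + h) @ ws) =
    (\<Sum>j\<le>m. real (m choose j) * A (replicate j z @ replicate (m - j) h @ ws))"
  using assms(2)
proof (induction m arbitrary: ws)
  case (Suc m)
  define a where "a j = A (replicate j z @ replicate (Suc m - j) h @ ws)" for j
  have "A (replicate (Suc m) (z + h) @ ws) =
      A (z # (replicate m (z + h) @ ws)) + A (h # (replicate m (z + h) @ ws))"
    using linear_add[OF sym_form_linear[OF assms(1), of "replicate m (z + h) @ ws"]] Suc.prems by simp
  also have "A (z # (replicate m (z + h) @ ws)) = A (replicate m (z + h) @ z # ws)"
    by (rule sym_form_mset[OF assms(1)]) simp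
  also have "\<dots> = (\<Sum>j\<le>m. real (m choose j) * A (replicate j z @ replicate (m - j) h @ z # ws))"
    using Suc by simp
  also have "\<dots> = (\<Sum>j\<le>m. real (m choose j) * a (Suc j))"
    unfolding a_def
    by (intro sum.cong arg_cong2[where f = "(*)"] sym_form_mset[OF assms(1)]) auto
  also have "A (h # (replicate m (z + h) @ ws)) = A (replicate m (z + h) @ h # ws)"
    by (rule sym_form_mset[OF assms(1)]) simp
  also have "\<dots> = (\<Sum>j\<le>m. real (m choose j) * A (replicate j z @ replicate (m - j) h @ h # ws))"
    using Suc by simp
  also have "\<dots> = (\<Sum>j\<le>m. real (m choose j) * a j)"
    unfolding a_def
    by (intro sum.cong arg_cong2[where f = "(*)"] sym_form_mset[OF assms(1)]) (auto simp: Suc_diff_le)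
  \<comment> \<open>The added term has the coefficient \<open>m choose Suc m\<close>, which is 0; it
    makes room for the index shift.\<close>
  also have "\<dots> = (\<Sum>j\<le>Suc m. real (m choose j) * a j)"
    by simp
  also have "\<dots> = a 0 + (\<Sum>j\<le>m. real (m choose Suc j) * a (Suc j))"
    by (simp only: sum.atMost_Suc_shift) simp
  finally have "A (replicate (Suc m) (z + h) @ ws) =
      a 0 + (\<Sum>j\<le>m. real (Suc m choose Suc j) * a (Suc j))"
    by (simp add: sum.distrib distrib_right)
  also have "\<dots> = (\<Sum>j\<le>Suc m. real (Suc m choose j) * a j)"
    by (simp only: sum.atMost_Suc_shift) simp
  finally show ?case
    unfolding a_def .
qed simp

text \<open>Polarization: with one more slot than \<open>hs\<close> has entries, a difference in
  direction \<open>h\<close> fixes \<open>h\<close> in one slot, with the number of slots as factor,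
  up to terms of too low degree to survive the remaining differences. The factors multiply to the
  factorial.\<close>

lemma iter_diff_sym_form:
  "A \<in> sym_forms (length hs) \<Longrightarrow>
    iter_diff hs (\<lambda>z. A (replicate (length hs) z)) x = fact (length hs) * A hs"
proof (induction hs arbitrary: A)
  case (Cons h hs)
  let ?k = "length hs"
  have A: "A \<in> sym_forms (Suc ?k)"
    using Cons.prems by simp
  \<comment> \<open>These are the binomial terms with fewer than \<open>?k\<close> copies of
    \<open>z\<close>. Of the other two, the one with \<open>Suc ?k\<close> copies cancels in the
    difference and the one with \<open>?k\<close> copies is the main term.\<close>
  define q where "q z =
    (\<Sum>j<?k. real (Suc ?k choose j) * A (replicate j z @ replicate (Suc ?k - j) h))" for z
  have "q \<in> polys_below ?k"
    unfolding q_def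
  proof (intro polys_below_sum polys_below_scale)
    fix j assume "j \<in> {..<?k}"
    then show "(\<lambda>z. A (replicate j z @ replicate (Suc ?k - j) h)) \<in> polys_below ?k"
      using sym_form_in_polys_below[OF A, of j "replicate (Suc ?k - j) h"]
        polys_below_mono[of "Suc j" ?k] by auto
  qed
  moreover have "A (replicate (Suc ?k) (z + h)) - A (replicate (Suc ?k) z) =
      real (Suc ?k) * A (h # replicate ?k z) + 1 * q z" for z
  proof -
    have "A (replicate ?k z @ replicate (Suc 0) h) = A (h # replicate ?k z)"
      by (rule sym_form_mset[OF A]) simp
    moreover have "A (replicate (Suc ?k) (z + h)) =
        (\<Sum>j\<le>Suc ?k. real (Suc ?k choose j) * A (replicate j z @ replicate (Suc ?k - j) h))"
      using sym_form_binomial[OF A, of "Suc ?k" "[]" z h] by simp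
    moreover have "{..Suc ?k} = insert (Suc ?k) (insert ?k {..<?k})"
      by auto
    ultimately show ?thesis
      by (simp add: q_def del: replicate.simps(2))
  qed
  moreover have "iter_diff hs (\<lambda>z. A (h # replicate ?k z)) x = fact ?k * A (h # hs)"
    using Cons.IH[OF sym_form_Cons[OF A]] .
  ultimately show ?case
    using iter_diff_linear[of hs "real (Suc ?k)" "\<lambda>z. A (h # replicate ?k z)" 1 q x]
    by (simp add: iter_diff_poly_eq_0 del: replicate.simps of_nat_Suc)
qed simp

subsection \<open>Mean oscillation on balls\<close>

lemma set_integrable_ball_continuous:
  fixes g :: "'a::euclidean_space \<Rightarrow> real"
  assumes "continuous_on UNIV g"
  shows "set_integrable lebesgue (ball x r) g"
proof (rule set_integrable_subset)
  have "integrable lborel (\<lambda>y. indicator (cball x r) y *\<^sub>R g y)"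
    using assms by (intro borel_integrable_compact) (auto intro: continuous_on_subset)
  then show "set_integrable lebesgue (cball x r) g"
    unfolding set_integrable_def using assms
    by (subst integrable_completion) (auto intro!: borel_measurable_continuous_onI)
qed auto

text \<open>Substitution with Jacobian \<open>r ^ DIM('a)\<close>. The integrands are Borel
  measurable, so the integrals pass to \<open>lborel\<close>, where the affine image of the measure
  is known.\<close>

lemma integral_ball_affine:
  fixes g :: "'a::euclidean_space \<Rightarrow> real"
  assumes g: "continuous_on UNIV g" and "r > 0"
  shows "(LINT y:ball x r|lebesgue. g y) =
    r ^ DIM('a) * (LINT y:ball 0 1|lebesgue. g (x + r *\<^sub>R y))"
proof -
  have g': "continuous_on UNIV (\<lambda>y. g (x + r *\<^sub>R y))"
    by (rule continuous_on_compose2[OF g]) (auto intro!: continuous_intros)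
  have meas: "(\<lambda>y. indicator (ball z R) y *\<^sub>R h y) \<in> borel_measurable borel"
    if "continuous_on UNIV h" for z :: 'a and R and h :: "'a \<Rightarrow> real"
    using that by (intro borel_measurable_scaleR borel_measurable_indicator borel_measurable_continuous_onI) auto
  have ind: "indicator (ball x r) (x + r *\<^sub>R y) = (indicator (ball 0 1) y :: real)" for y
    using \<open>r > 0\<close> by (auto simp: indicator_def dist_norm)
  have "(LINT y:ball x r|lebesgue. g y) = (LINT y|lborel. indicator (ball x r) y *\<^sub>R g y)"
    unfolding set_lebesgue_integral_def by (rule integral_completion) (simp add: meas g del: real_scaleR_def)
  also have "\<dots> = (LINT y|density (distr lborel borel (\<lambda>y. x + r *\<^sub>R y)) (\<lambda>_. \<bar>r\<bar> ^ DIM('a)).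
      indicator (ball x r) y *\<^sub>R g y)"
    using lborel_affine[of r x] \<open>r > 0\<close> by simp
  also have "\<dots> = (LINT y|lborel. r ^ DIM('a) * (indicator (ball 0 1) y *\<^sub>R g (x + r *\<^sub>R y)))"
    using \<open>r > 0\<close>
    using meas[OF g, of x r]
    by (subst integral_density) (auto simp: integral_distr ind)
  also have "\<dots> = r ^ DIM('a) * (LINT y|lborel. indicator (ball 0 1) y *\<^sub>R g (x + r *\<^sub>R y))"
    by simp
  also have "(LINT y|lborel. indicator (ball 0 1) y *\<^sub>R g (x + r *\<^sub>R y)) =
      (LINT y:ball 0 1|lebesgue. g (x + r *\<^sub>R y))"
    unfolding set_lebesgue_integral_def by (rule integral_completion[symmetric]) (simp add: meas g' del: real_scaleR_def)
  finally show ?thesis .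
qed

section \<open>Means and polynomial oscillation on the unit ball\<close>

definition ball_mean :: "('a::euclidean_space \<Rightarrow> real) \<Rightarrow> real" where
  "ball_mean g = (1 / measure lebesgue (ball (0 :: 'a) 1)) * (LINT y:ball 0 1|lebesgue. g y)"

text \<open>With centre and radius moved into the function, oscillations on different balls become
  comparable; \<open>osc_eq_unit_osc\<close> is the link.\<close>

definition unit_osc :: "nat \<Rightarrow> (real ^ 'n \<Rightarrow> real) \<Rightarrow> real" where
  "unit_osc k g = (INF P\<in>polys_below k. ball_mean (\<lambda>y. \<bar>g y - P y\<bar>))"

lemma measure_unit_ball_pos: "measure lebesgue (ball (0 :: 'a::euclidean_space) 1) > 0"
  using content_ball_pos[of 1 "0 :: 'a"] by simp

lemma ball_mean_mono:
  assumes "continuous_on UNIV g" "continuous_on UNIV h" "\<And>y. norm y < 1 \<Longrightarrow> g y \<le> h y"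
  shows "ball_mean g \<le> ball_mean h"
  unfolding ball_mean_def
  using assms
  by (intro mult_left_mono set_integral_mono set_integrable_ball_continuous) auto

lemma ball_mean_add:
  assumes "continuous_on UNIV g" "continuous_on UNIV h"
  shows "ball_mean (\<lambda>y. g y + h y) = ball_mean g + ball_mean h"
  unfolding ball_mean_def
  using assms by (simp add: set_integral_add set_integrable_ball_continuous distrib_left)

lemma ball_mean_const: "ball_mean (\<lambda>_ :: 'a::euclidean_space. c) = c"
  using measure_unit_ball_pos[where 'a = 'a]
  by (simp add: ball_mean_def set_lebesgue_integral_def)

lemma ball_mean_mult: "ball_mean (\<lambda>y. c * g y) = c * ball_mean g"
  by (simp add: ball_mean_def)

lemma ball_mean_nonneg: "(\<And>y. 0 \<le> g y) \<Longrightarrow> 0 \<le> ball_mean g"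
  unfolding ball_mean_def set_lebesgue_integral_def
  by (intro mult_nonneg_nonneg Bochner_Integration.integral_nonneg) auto

lemma unit_osc_le: "P \<in> polys_below k \<Longrightarrow> unit_osc k g \<le> ball_mean (\<lambda>y. \<bar>g y - P y\<bar>)"
  unfolding unit_osc_def
  by (rule cINF_lower) (auto intro!: bdd_belowI2[of _ 0] ball_mean_nonneg)

lemma unit_osc_greatest:
  "(\<And>P. P \<in> polys_below k \<Longrightarrow> m \<le> ball_mean (\<lambda>y. \<bar>g y - P y\<bar>)) \<Longrightarrow> m \<le> unit_osc k g"
  unfolding unit_osc_def
  by (rule cINF_greatest) (use zero_in_polys_below in auto)

text \<open>A competitor \<open>P\<close> for \<open>g\<close> gives the competitor
  \<open>q y + c * P y\<close> for the left side, and its error is \<open>c\<close> times as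
  large.\<close>

lemma unit_osc_affine_le:
  assumes q: "q \<in> polys_below k" and "c > 0"
  shows "unit_osc k (\<lambda>y. q y + c * g y) \<le> c * unit_osc k g"
proof -
  have "unit_osc k (\<lambda>y. q y + c * g y) / c \<le> unit_osc k g"
  proof (rule unit_osc_greatest)
    fix P :: "real ^ 'a \<Rightarrow> real" assume "P \<in> polys_below k"
    then have "(\<lambda>y. q y + c * P y) \<in> polys_below k"
      by (intro polys_below_add polys_below_scale q)
    then have "unit_osc k (\<lambda>y. q y + c * g y) \<le>
        ball_mean (\<lambda>y. \<bar>q y + c * g y - (q y + c * P y)\<bar>)"
      by (rule unit_osc_le)
    also have "(\<lambda>y. \<bar>q y + c * g y - (q y + c * P y)\<bar>) = (\<lambda>y. c * \<bar>g y - P y\<bar>)"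
      using \<open>c > 0\<close> by (simp add: fun_eq_iff abs_mult flip: right_diff_distrib)
    finally show "unit_osc k (\<lambda>y. q y + c * g y) / c \<le> ball_mean (\<lambda>y. \<bar>g y - P y\<bar>)"
      using \<open>c > 0\<close> by (simp add: ball_mean_mult divide_simps mult.commute)
  qed
  then show ?thesis
    using \<open>c > 0\<close> by (simp add: divide_simps mult.commute)
qed

lemma unit_osc_affine:
  assumes q: "q \<in> polys_below k" and "c > 0"
  shows "unit_osc k (\<lambda>y. q y + c * g y) = c * unit_osc k g"
proof (rule antisym)
  \<comment> \<open>The reverse inequality is the same estimate for the inverse substitution, which
    recovers \<open>g\<close> from \<open>q y + c * g y\<close>.\<close>
  have "unit_osc k (\<lambda>y. (-1 / c) * q y + (1 / c) * (q y + c * g y)) \<le>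
      (1 / c) * unit_osc k (\<lambda>y. q y + c * g y)"
    using assms by (intro unit_osc_affine_le polys_below_scale) auto
  then show "c * unit_osc k g \<le> unit_osc k (\<lambda>y. q y + c * g y)"
    using \<open>c > 0\<close> by (simp add: divide_simps mult.commute distrib_left)
qed (rule unit_osc_affine_le[OF assms])

text \<open>Each competitor for \<open>h\<close> also competes for \<open>g\<close>, at an extra
  mean cost of at most \<open>e\<close>; exchanging \<open>g\<close> and \<open>h\<close> gives the
  absolute value.\<close>

lemma unit_osc_perturb:
  assumes "continuous_on UNIV g" "continuous_on UNIV h"
    and le: "\<And>y. norm y < 1 \<Longrightarrow> \<bar>g y - h y\<bar> \<le> e"
  shows "\<bar>unit_osc k g - unit_osc k h\<bar> \<le> e"
proof -
  have *: "unit_osc k g - e \<le> unit_osc k h"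
    if "continuous_on UNIV g" "continuous_on UNIV h"
      and le: "\<And>y. norm y < 1 \<Longrightarrow> \<bar>g y - h y\<bar> \<le> e" for g h :: "real ^ 'a \<Rightarrow> real"
  proof (rule unit_osc_greatest)
    fix P :: "real ^ 'a \<Rightarrow> real" assume P: "P \<in> polys_below k"
    note cont = that(1,2) polys_below_continuous[OF P, of UNIV]
    have "unit_osc k g \<le> ball_mean (\<lambda>y. \<bar>g y - P y\<bar>)"
      by (rule unit_osc_le[OF P])
    also have "\<dots> \<le> ball_mean (\<lambda>y. \<bar>h y - P y\<bar> + e)"
    proof (rule ball_mean_mono)
      show "\<bar>g y - P y\<bar> \<le> \<bar>h y - P y\<bar> + e" if "norm y < 1" for y
        using le[OF that] by linarith
    qed (intro continuous_intros cont)+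
    also have "\<dots> = ball_mean (\<lambda>y. \<bar>h y - P y\<bar>) + e"
      by (subst ball_mean_add) (auto simp: ball_mean_const intro!: continuous_intros cont)
    finally show "unit_osc k g - e \<le> ball_mean (\<lambda>y. \<bar>h y - P y\<bar>)"
      by simp
  qed
  show ?thesis
    using *[of g h] *[of h g] assms by (simp add: abs_le_iff abs_minus_commute)
qed

text \<open>The Jacobian cancels against the volume of the ball, and composition with the affine map
  permutes the admissible polynomials.\<close>

lemma osc_eq_unit_osc:
  fixes f :: "real ^ 'n \<Rightarrow> real"
  assumes f: "continuous_on UNIV f" and "k \<ge> 1" "r > 0"
  shows "osc k f x r = unit_osc k (\<lambda>y. f (x + r *\<^sub>R y))"
proof -
  have mean: "(1 / measure lebesgue (ball x r)) * (LINT y:ball x r|lebesgue. \<bar>f y - P y\<bar>) =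
      ball_mean (\<lambda>y. \<bar>f (x + r *\<^sub>R y) - P (x + r *\<^sub>R y)\<bar>)"
    if P: "P \<in> polys_below k" for P
  proof -
    have "(LINT y:ball x r|lebesgue. \<bar>f y - P y\<bar>) =
        r ^ CARD('n) * (LINT y:ball 0 1|lebesgue. \<bar>f (x + r *\<^sub>R y) - P (x + r *\<^sub>R y)\<bar>)"
      using integral_ball_affine[of "\<lambda>y. \<bar>f y - P y\<bar>" r x] \<open>r > 0\<close>
      by (simp add: continuous_intros f polys_below_continuous[OF P])
    moreover have "measure lebesgue (ball x r) = r ^ CARD('n) * measure lebesgue (ball (0 :: real ^ 'n) 1)"
      using content_ball_conv_unit_ball[of r x] \<open>r > 0\<close> by simp
    ultimately show ?thesis
      using \<open>r > 0\<close> by (simp add: ball_mean_def)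
  qed
  have images: "(\<lambda>P. ball_mean (\<lambda>y. \<bar>f (x + r *\<^sub>R y) - P (x + r *\<^sub>R y)\<bar>)) ` polys_below k =
      (\<lambda>P. ball_mean (\<lambda>y. \<bar>f (x + r *\<^sub>R y) - P y\<bar>)) ` polys_below k" (is "?F ` _ = ?G ` _")
  proof (intro equalityI subsetI)
    fix m assume "m \<in> ?F ` polys_below k"
    then obtain P where P: "P \<in> polys_below k" and m: "m = ?F P" by blast
    show "m \<in> ?G ` polys_below k"
      unfolding m by (rule image_eqI[OF _ polys_below_affine[OF P, of x r]]) simp
  next
    \<comment> \<open>The preimage is \<open>P\<close> composed with the inverse map, which sends
      \<open>y\<close> to \<open>(y - x) / r\<close>.\<close>
    fix m assume "m \<in> ?G ` polys_below k"
    then obtain P where P: "P \<in> polys_below k" and m: "m = ?G P" by blast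
    show "m \<in> ?F ` polys_below k"
      unfolding m
      by (rule image_eqI[OF _ polys_below_affine[OF P, of "- (1 / r) *\<^sub>R x" "1 / r"]])
         (use \<open>r > 0\<close> in \<open>simp add: algebra_simps\<close>)
  qed
  show ?thesis
    unfolding osc_def unit_osc_def polys_upto_eq_polys_below[OF \<open>k \<ge> 1\<close>] images[symmetric]
    by (simp only: mean cong: INF_cong)
qed

lemma sym_form_poly_continuous:
  assumes "A \<in> sym_forms k"
  shows "continuous_on S (form_poly k A)"
  using polys_below_continuous[OF sym_form_in_polys_below[OF assms, of k "[]"]]
  unfolding form_poly_def[abs_def] by (auto intro!: continuous_intros)

lemma osc_const_eq_unit_osc:
  assumes "continuous_on UNIV (form_poly k A)" "k \<ge> 1"
  shows "osc_const k A = unit_osc k (form_poly k A)"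
  using osc_eq_unit_osc[OF assms, of 1 0] by (simp add: osc_const_def)

subsection \<open>Comparison with the Euclidean norm\<close>

lemma component_le_form_norm:
  fixes A :: "(real ^ 'n) list \<Rightarrow> real"
  assumes "length is = k"
  shows "\<bar>A (map (\<lambda>i. axis i 1) is)\<bar> \<le> form_norm k A"
proof -
  have "(A (map (\<lambda>i. axis i 1) is))\<^sup>2 \<le> (\<Sum>is | length is = k. (A (map (\<lambda>i. axis i 1) is))\<^sup>2)"
    using assms by (intro member_le_sum[of "is"]) (auto simp: finite_index_lists)
  then show ?thesis
    unfolding form_norm_def by (intro real_le_rsqrt) simp
qed

lemma form_norm_le_sum:
  fixes A :: "(real ^ 'n) list \<Rightarrow> real"
  shows "form_norm k A \<le> (\<Sum>is | length is = k. \<bar>A (map (\<lambda>i. axis i 1) is)\<bar>)"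
  using L2_set_le_sum_abs unfolding form_norm_def L2_set_def .

text \<open>The constant is the factor in \<open>sym_form_bound\<close> for \<open>k\<close> copies
  of \<open>y\<close>, divided by the factorial in \<open>form_poly\<close>.\<close>

lemma osc_const_upper:
  fixes A :: "(real ^ 'n) list \<Rightarrow> real"
  assumes A: "A \<in> sym_forms k" and "k \<ge> 1"
  shows "osc_const k A \<le> real CARD('n) ^ k / fact k * form_norm k A"
proof -
  have "osc_const k A \<le> ball_mean (\<lambda>y. \<bar>form_poly k A y - 0\<bar>)"
    unfolding osc_const_eq_unit_osc[OF sym_form_poly_continuous[OF A] \<open>k \<ge> 1\<close>]
    by (rule unit_osc_le) (rule zero_in_polys_below)
  also have "\<dots> \<le> ball_mean (\<lambda>_ :: real ^ 'n. real CARD('n) ^ k / fact k * form_norm k A)"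
  proof (rule ball_mean_mono)
    fix y :: "real ^ 'n" assume "norm y < 1"
    then show "\<bar>form_poly k A y - 0\<bar> \<le> real CARD('n) ^ k / fact k * form_norm k A"
      using sym_form_bound[OF A component_le_form_norm, of k y k "[]"]
      by (simp add: form_poly_def abs_mult divide_right_mono)
  qed (intro continuous_intros sym_form_poly_continuous[OF A])+
  finally show ?thesis
    by (simp add: ball_mean_const)
qed

section \<open>Integral bounds for iterated differences and the lower bound\<close>

lemma integral_ball_shift:
  fixes g :: "'a::euclidean_space \<Rightarrow> real"
  assumes g: "continuous_on UNIV g"
  shows "(LINT y:ball 0 r|lebesgue. g (y + h)) = (LINT y:ball h r|lebesgue. g y)"
proof (cases "r > 0")
  case True
  then show ?thesis
    using integral_ball_affine[OF continuous_on_shift[OF g], of r 0 h] integral_ball_affine[OF g, of r h]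
    by (simp add: add.commute)
next
  case False
  then have "ball x r = {}" for x :: 'a
    by simp
  then show ?thesis
    by (simp only:) (simp add: set_lebesgue_integral_def)
qed

lemma integral_ball_mono:
  fixes g :: "'a::euclidean_space \<Rightarrow> real"
  assumes "continuous_on UNIV g" "\<And>y. 0 \<le> g y" "ball a r \<subseteq> ball b s"
  shows "(LINT y:ball a r|lebesgue. g y) \<le> (LINT y:ball b s|lebesgue. g y)"
  using set_integrable_ball_continuous[OF assms(1)] assms(2,3)
  unfolding set_lebesgue_integral_def set_integrable_def
  by (intro integral_mono) (auto simp: indicator_def)

text \<open>By the triangle inequality each difference at most doubles the integral, and its shift
  moves the ball by at most \<open>s\<close>.\<close>

lemma integral_iter_diff_le:
  fixes g :: "'a::euclidean_space \<Rightarrow> real"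
  assumes "continuous_on UNIV g" "\<And>h. h \<in> set hs \<Longrightarrow> norm h \<le> s"
  shows "(LINT y:ball 0 r|lebesgue. \<bar>iter_diff hs g y\<bar>) \<le>
    2 ^ length hs * (LINT y:ball 0 (r + s * length hs)|lebesgue. \<bar>g y\<bar>)"
  using assms
proof (induction hs arbitrary: g)
  case (Cons h hs)
  define R where "R = r + s * length hs"
  have "0 \<le> norm h" "norm h \<le> s"
    using Cons.prems(2)[of h] by auto
  note g = Cons.prems(1)
  note int = set_integrable_ball_continuous[OF continuous_on_rabs]
  note gh = continuous_on_shift[OF g, of h]
  have "(LINT y:ball 0 r|lebesgue. \<bar>iter_diff (h # hs) g y\<bar>) \<le>
      2 ^ length hs * (LINT y:ball 0 R|lebesgue. \<bar>g (y + h) - g y\<bar>)"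
    unfolding R_def iter_diff.simps
    using Cons.prems(2) by (intro Cons.IH continuous_on_diff g gh) auto
  also have "(LINT y:ball 0 R|lebesgue. \<bar>g (y + h) - g y\<bar>) \<le>
      (LINT y:ball 0 R|lebesgue. \<bar>g (y + h)\<bar> + \<bar>g y\<bar>)"
    by (intro set_integral_mono set_integral_add int continuous_on_diff g gh) auto
  also have "\<dots> = (LINT y:ball h R|lebesgue. \<bar>g y\<bar>) + (LINT y:ball 0 R|lebesgue. \<bar>g y\<bar>)"
    using integral_ball_shift[OF continuous_on_rabs[OF g]]
    by (simp add: set_integral_add(2) int g gh)
  also have "\<dots> \<le> (LINT y:ball 0 (R + s)|lebesgue. \<bar>g y\<bar>) + (LINT y:ball 0 (R + s)|lebesgue. \<bar>g y\<bar>)"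
  proof (intro add_mono integral_ball_mono continuous_on_rabs g)
    show "ball h R \<subseteq> ball 0 (R + s)" "ball 0 R \<subseteq> ball 0 (R + s)"
      using order_trans[OF \<open>0 \<le> norm h\<close> \<open>norm h \<le> s\<close>] \<open>norm h \<le> s\<close>
      by (auto simp: ball_subset_ball_iff)
  qed auto
  also have "R + s = r + s * length (h # hs)"
    by (simp add: R_def algebra_simps)
  finally show ?case
    by simp
qed simp

text \<open>The \<open>k\<close>-fold difference kills \<open>P\<close> and turns \<open>form_poly k A\<close> into the constant \<open>A hs\<close>. With steps
  of length \<open>1 / (2 k)\<close> and base points in \<open>ball 0 (1 / 2)\<close> it only uses values in the unit ball.\<close>

lemma component_le_osc_const:
  fixes A :: "(real ^ 'n) list \<Rightarrow> real"
  assumes A: "A \<in> sym_forms k" and "k \<ge> 1" and len: "length is = k"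
  shows "(1 / (2 * real k)) ^ k * (1 / 2) ^ CARD('n) / 2 ^ k * \<bar>A (map (\<lambda>i. axis i 1) is)\<bar> \<le> osc_const k A"
  unfolding osc_const_eq_unit_osc[OF sym_form_poly_continuous[OF A] \<open>k \<ge> 1\<close>]
proof (rule unit_osc_greatest)
  fix P :: "real ^ 'n \<Rightarrow> real" assume P: "P \<in> polys_below k"
  define s where "s = 1 / (2 * real k)"
  define hs where "hs = map (\<lambda>i. s *\<^sub>R axis i (1 :: real)) is"
  define g where "g y = form_poly k A y - P y" for y
  have [simp]: "length hs = k"
    by (simp add: hs_def len)
  have s: "s \<ge> 0" "s * k = 1 / 2"
    using \<open>k \<ge> 1\<close> by (auto simp: s_def)
  have cont: "continuous_on UNIV g"
    unfolding g_def by (intro continuous_intros sym_form_poly_continuous[OF A] polys_below_continuous[OF P])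
  \<comment> \<open>The factor \<open>1 / fact k\<close> in \<open>form_poly\<close> cancels the
    factorial from polarization, and \<open>s\<close> comes out of each of the \<open>k\<close>
    arguments.\<close>
  have diff: "iter_diff hs g y = s ^ k * A (map (\<lambda>i. axis i 1) is)" for y
  proof -
    have "iter_diff hs g y =
        iter_diff hs (\<lambda>y. (1 / fact k) * A (replicate (length hs) y) + (- 1) * P y) y"
      by (rule arg_cong[where f = "\<lambda>g. iter_diff hs g y"]) (simp add: g_def form_poly_def fun_eq_iff)
    also have "\<dots> = A hs"
      using iter_diff_sym_form[of A hs y] iter_diff_poly_eq_0[of P hs y] A P
      by (simp only: iter_diff_linear) simp
    also have "\<dots> = s ^ k * A (map (\<lambda>i. axis i 1) is)"
      using sym_form_scale[OF A, of "map (\<lambda>i. axis i 1) is" "[]" s] len by (simp add: hs_def o_def)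
    finally show ?thesis .
  qed
  define V where "V = measure lebesgue (ball (0 :: real ^ 'n) 1)"
  have "V > 0"
    unfolding V_def by (rule measure_unit_ball_pos)
  have "s ^ k * \<bar>A (map (\<lambda>i. axis i 1) is)\<bar> * ((1 / 2) ^ CARD('n) * V) =
      (LINT y:ball (0 :: real ^ 'n) (1 / 2)|lebesgue. \<bar>iter_diff hs g y\<bar>)"
    using content_ball_conv_unit_ball[of "1 / 2" "0 :: real ^ 'n"] s
    by (simp add: diff set_lebesgue_integral_def abs_mult V_def)
  \<comment> \<open>The radius on the right is \<open>1 / 2 + s * k\<close>, which is exactly
    1.\<close>
  also have "\<dots> \<le> 2 ^ length hs * (LINT y:ball 0 (1 / 2 + s * length hs)|lebesgue. \<bar>g y\<bar>)"
    using s by (intro integral_iter_diff_le cont) (auto simp: hs_def)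
  finally have "s ^ k * \<bar>A (map (\<lambda>i. axis i 1) is)\<bar> * ((1 / 2) ^ CARD('n) * V) \<le>
      2 ^ k * (LINT y:ball 0 1|lebesgue. \<bar>g y\<bar>)"
    by (simp add: s)
  then have "s ^ k * (1 / 2) ^ CARD('n) / 2 ^ k * \<bar>A (map (\<lambda>i. axis i 1) is)\<bar>
      \<le> (LINT y:ball 0 1|lebesgue. \<bar>g y\<bar>) / V"
    using \<open>V > 0\<close> by (simp add: divide_simps ac_simps)
  then show "(1 / (2 * real k)) ^ k * (1 / 2) ^ CARD('n) / 2 ^ k * \<bar>A (map (\<lambda>i. axis i 1) is)\<bar> \<le>
      ball_mean (\<lambda>y. \<bar>form_poly k A y - P y\<bar>)"
    by (simp add: ball_mean_def s_def g_def V_def)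
qed

text \<open>The Euclidean norm is at most the sum of the absolute components; adding the estimates
  of all \<open>N\<close> components costs the factor \<open>N\<close>.\<close>

lemma osc_const_lower:
  fixes k :: nat
  assumes "k \<ge> 1"
  obtains a where "a > 0"
    "\<And>A. A \<in> (sym_forms k :: ((real ^ 'n) list \<Rightarrow> real) set) \<Longrightarrow> a * form_norm k A \<le> osc_const k A"
proof
  define c where "c = (1 / (2 * real k)) ^ k * (1 / 2) ^ CARD('n) / 2 ^ k"
  define N where "N = card {is :: 'n list. length is = k}"
  have "c > 0"
    using assms by (simp add: c_def)
  have "{is :: 'n list. length is = k} \<noteq> {}"
    by (auto intro: length_replicate)
  then have "N > 0"
    by (simp add: N_def card_gt_0_iff finite_index_lists)
  then show "c / N > 0"
    using \<open>c > 0\<close> by simp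
  fix A :: "(real ^ 'n) list \<Rightarrow> real" assume A: "A \<in> sym_forms k"
  have "c * form_norm k A \<le> (\<Sum>is | length is = k. c * \<bar>A (map (\<lambda>i. axis i 1) is)\<bar>)"
    using form_norm_le_sum[of k A] \<open>c > 0\<close> by (simp flip: sum_distrib_left)
  also have "\<dots> \<le> (\<Sum>is :: 'n list | length is = k. osc_const k A)"
    unfolding c_def by (intro sum_mono component_le_osc_const A assms) auto
  finally show "c / N * form_norm k A \<le> osc_const k A"
    using \<open>N > 0\<close> by (simp add: N_def divide_simps mult.commute)
qed

subsection \<open>Taylor's formula\<close>

lemma Ck_fun_continuous: "Ck_fun k f \<Longrightarrow> continuous_on UNIV f"
  by (cases k) (auto intro!: continuous_at_imp_continuous_on differentiable_imp_continuous_within)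

text \<open>The head of the list is differentiated last, so the induction keeps one order of
  smoothness in reserve for it.\<close>

lemma Ck_fun_iter_partial: "Ck_fun (m + length is) f \<Longrightarrow> Ck_fun m (iter_partial is f)"
proof (induction "is" arbitrary: m)
  case (Cons i "is")
  then show ?case
    using Cons.IH[of "Suc m"] by simp
qed simp

lemma has_field_derivative_line:
  fixes g :: "'a::real_normed_vector \<Rightarrow> real"
  assumes "(g has_derivative g') (at (x + t *\<^sub>R y))"
  shows "((\<lambda>t. g (x + t *\<^sub>R y)) has_field_derivative g' y) (at t)"
proof -
  have "((\<lambda>t. x + t *\<^sub>R y) has_derivative (\<lambda>t. t *\<^sub>R y)) (at t)"
    by (auto intro!: derivative_eq_intros)
  from has_derivative_compose[OF this assms] show ?thesis
    using linear_cmul[OF has_derivative_linear[OF assms], of _ y]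
    by (simp add: has_field_derivative_def mult_commute_abs)
qed

lemma line_derivative_partial_derivs:
  fixes g :: "real ^ 'n \<Rightarrow> real"
  assumes "g differentiable (at (x + t *\<^sub>R y))"
  shows "((\<lambda>t. g (x + t *\<^sub>R y)) has_field_derivative
    (\<Sum>i\<in>UNIV. partial_deriv i g (x + t *\<^sub>R y) * y $ i)) (at t)"
proof -
  obtain g' where g': "(g has_derivative g') (at (x + t *\<^sub>R y))"
    using assms unfolding differentiable_def by blast
  \<comment> \<open>A partial derivative is itself a line derivative, in the direction of a basis
    vector.\<close>
  have "partial_deriv i g (x + t *\<^sub>R y) = g' (axis i 1)" for i
    unfolding partial_deriv_def
    by (rule DERIV_imp_deriv, rule has_field_derivative_line) (use g' in simp)
  then have "(\<Sum>i\<in>UNIV. partial_deriv i g (x + t *\<^sub>R y) * y $ i) = g' y"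
    using linear_expansion[OF has_derivative_linear[OF g'], of y] by (simp add: mult.commute)
  then show ?thesis
    using has_field_derivative_line[OF g'] by simp
qed

section \<open>Derivative forms on the diagonal and along lines\<close>

lemma sum_lists_Suc:
  "(\<Sum>is | length is = Suc m. F is) =
    (\<Sum>is | length is = m. \<Sum>i\<in>(UNIV :: 'n::finite set). F (i # is))"
proof -
  have "{is :: 'n list. length is = Suc m} = (\<lambda>(is, i). i # is) ` ({is. length is = m} \<times> UNIV)"
    by (force simp: length_Suc_conv)
  then have "(\<Sum>is | length is = Suc m. F is) =
      (\<Sum>(is, i)\<in>{is. length is = m} \<times> UNIV. F (i # is))"
    by (simp only:) (subst sum.reindex, auto simp: inj_on_def intro: sum.cong)
  then show ?thesis
    by (simp add: sum.cartesian_product)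
qed

lemma deriv_form_diag:
  "deriv_form m f x (replicate m y) =
    (\<Sum>is | length is = m. iter_partial is f x * (\<Prod>j<m. y $ (is ! j)))"
  by (simp add: deriv_form_def)

lemma deriv_form_diag_scale:
  "deriv_form m f x (replicate m (r *\<^sub>R y)) = r ^ m * deriv_form m f x (replicate m y)"
  by (simp add: deriv_form_diag prod.distrib sum_distrib_left mult.left_commute)

lemma deriv_form_diag_in_polys_below:
  fixes f :: "real ^ 'n \<Rightarrow> real"
  shows "(\<lambda>y. deriv_form m f x (replicate m y)) \<in> polys_below (Suc m)"
proof -
  have "(\<lambda>y :: real ^ 'n. \<Prod>j<length is. y $ (is ! j)) \<in> polys_below (Suc (length is))" for "is"
  proof (induction "is")
    case (Cons i "is")
    show ?case
      using polys_below_mult_coord[OF Cons.IH, of i]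
      by (simp add: prod.lessThan_Suc_shift del: prod.lessThan_Suc)
  qed (simp add: one_in_polys_below)
  then show ?thesis
    unfolding deriv_form_diag by (intro polys_below_sum polys_below_scale) auto
qed

lemma deriv_form_line_derivative:
  fixes f :: "real ^ 'n \<Rightarrow> real"
  assumes "Ck_fun k f" "m < k"
  shows "((\<lambda>t. deriv_form m f (x + t *\<^sub>R y) (replicate m y)) has_field_derivative
    deriv_form (Suc m) f (x + t *\<^sub>R y) (replicate (Suc m) y)) (at t)"
proof -
  have "((\<lambda>t. iter_partial is f (x + t *\<^sub>R y) * (\<Prod>j<m. y $ (is ! j))) has_field_derivative
      (\<Sum>i\<in>UNIV. iter_partial (i # is) f (x + t *\<^sub>R y) * y $ i) * (\<Prod>j<m. y $ (is ! j))) (at t)"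
    if "length is = m" for "is"
  proof -
    \<comment> \<open>After \<open>m < k\<close> derivatives at least one order of smoothness is
      left, enough for Frechet differentiability.\<close>
    have "k = Suc (k - Suc m) + length is"
      using that \<open>m < k\<close> by simp
    with assms have "Ck_fun (Suc (k - Suc m)) (iter_partial is f)"
      using Ck_fun_iter_partial by metis
    then show ?thesis
      using line_derivative_partial_derivs[of "iter_partial is f" x t y]
      by (intro DERIV_cmult_right) auto
  qed
  then have "((\<lambda>t. \<Sum>is | length is = m. iter_partial is f (x + t *\<^sub>R y) * (\<Prod>j<m. y $ (is ! j)))
      has_field_derivative (\<Sum>is | length is = m.
        (\<Sum>i\<in>UNIV. iter_partial (i # is) f (x + t *\<^sub>R y) * y $ i) * (\<Prod>j<m. y $ (is ! j)))) (at t)"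
    by (intro DERIV_sum) auto
  \<comment> \<open>The new derivative index is the head of a list of length \<open>Suc m\<close>,
    so \<open>sum_lists_Suc\<close> regroups the double sum into the next form.\<close>
  then show ?thesis
    by (simp add: deriv_form_diag sum_lists_Suc prod.lessThan_Suc_shift sum_distrib_right mult.assoc
        del: prod.lessThan_Suc replicate.simps iter_partial.simps)
qed

text \<open>Maclaurin's formula with Lagrange remainder for the restriction of \<open>f\<close> to
  the line through \<open>x\<close> in direction \<open>y\<close>, at parameter 1.\<close>

lemma Taylor_Ck:
  fixes f :: "real ^ 'n \<Rightarrow> real"
  assumes "Ck_fun k f"
  obtains \<theta> where "0 < \<theta>" "\<theta> \<le> 1"
    "f (x + y) = (\<Sum>m<k. deriv_form m f x (replicate m y) / fact m) +
      form_poly k (deriv_form k f (x + \<theta> *\<^sub>R y)) y"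
proof -
  define D where "D m t = deriv_form m f (x + t *\<^sub>R y) (replicate m y)" for m t
  have "D 0 = (\<lambda>t. f (x + t *\<^sub>R y))"
    by (simp add: D_def deriv_form_def fun_eq_iff)
  moreover have "DERIV (D m) t :> D (Suc m) t" if "m < k" for m t
    unfolding D_def by (rule deriv_form_line_derivative[OF assms that])
  ultimately obtain \<theta> where "0 < \<theta>" "\<theta> \<le> 1"
    "f (x + 1 *\<^sub>R y) = (\<Sum>m<k. D m 0 / fact m * 1 ^ m) + D k \<theta> / fact k * 1 ^ k"
    using Maclaurin2[of 1 D "\<lambda>t. f (x + t *\<^sub>R y)" k] by auto
  then show thesis
    by (intro that[of \<theta>]) (simp_all add: D_def form_poly_def)
qed

text \<open>On the unit ball every product of coordinates is at most 1 in absolute value, and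
  dividing by the factorial only decreases the bound.\<close>

lemma form_poly_deriv_form_diff_le:
  fixes f :: "real ^ 'n \<Rightarrow> real"
  assumes "norm y \<le> 1"
  shows "\<bar>form_poly k (deriv_form k f z) y - form_poly k (deriv_form k f x) y\<bar> \<le>
    (\<Sum>is | length is = k. \<bar>iter_partial is f z - iter_partial is f x\<bar>)"
proof -
  have mon: "\<bar>\<Prod>j<k. y $ (is ! j)\<bar> \<le> 1" for "is"
    unfolding abs_prod using assms component_le_norm_cart[of y]
    by (intro prod_le_1) (auto intro: order_trans)
  have "\<bar>form_poly k (deriv_form k f z) y - form_poly k (deriv_form k f x) y\<bar> =
      \<bar>\<Sum>is | length is = k. (iter_partial is f z - iter_partial is f x) * (\<Prod>j<k. y $ (is ! j))\<bar> / fact k"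
    by (simp add: form_poly_def deriv_form_diag left_diff_distrib sum_subtractf flip: diff_divide_distrib)
  also have "\<dots> \<le> \<bar>\<Sum>is | length is = k. (iter_partial is f z - iter_partial is f x) * (\<Prod>j<k. y $ (is ! j))\<bar> / 1"
    by (rule divide_left_mono) (auto simp: fact_ge_1)
  also have "\<dots> \<le> (\<Sum>is | length is = k. \<bar>iter_partial is f z - iter_partial is f x\<bar> * \<bar>\<Prod>j<k. y $ (is ! j)\<bar>)"
    by (simp add: abs_mult[symmetric] sum_abs)
  also have "\<dots> \<le> (\<Sum>is | length is = k. \<bar>iter_partial is f z - iter_partial is f x\<bar> * 1)"
    by (intro sum_mono mult_left_mono mon) auto
  finally show ?thesis by simp
qed

section \<open>The limit of the rescaled oscillation\<close>

lemma osc_limit: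
  fixes f :: "real ^ 'n \<Rightarrow> real"
  assumes f: "Ck_fun k f" and "k \<ge> 1"
  shows "((\<lambda>r. osc k f x r / r ^ k) \<longlongrightarrow> osc_const k (deriv_form k f x)) (at_right 0)"
proof (rule tendstoI)
  fix e :: real assume "e > 0"
  let ?D = "form_poly k (deriv_form k f x)"
  have D: "continuous_on UNIV ?D"
    using polys_below_continuous[OF deriv_form_diag_in_polys_below]
    unfolding form_poly_def[abs_def] by (auto intro!: continuous_intros)
  have cont: "continuous_on UNIV f"
    using f by (rule Ck_fun_continuous)
  \<comment> \<open>The total change of the partial derivatives of order \<open>k\<close> from
    \<open>x\<close> to \<open>z\<close>; it will bound the Taylor error uniformly on the unit
    ball.\<close>
  define \<omega> where "\<omega> z = (\<Sum>is | length is = k. \<bar>iter_partial is f z - iter_partial is f x\<bar>)" for z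
  have "continuous_on UNIV (iter_partial is f)" if "length is = k" for "is"
    using Ck_fun_iter_partial[of 0 "is" f] f that by simp
  then have "continuous_on UNIV \<omega>"
    unfolding \<omega>_def by (intro continuous_intros) auto
  moreover have "\<omega> x = 0"
    by (simp add: \<omega>_def)
  ultimately obtain d where "d > 0" and d: "\<And>z. dist z x < d \<Longrightarrow> \<omega> z < e / 2"
    using \<open>e > 0\<close> unfolding continuous_on_iff dist_real_def
    by (metis UNIV_I abs_ge_self diff_zero half_gt_zero le_less_trans)
  \<comment> \<open>\<open>unit_osc_perturb\<close> gives only a weak inequality;
    \<open>e / 2\<close> secures the strict one at the end.\<close>
  have "\<bar>osc k f x r / r ^ k - osc_const k (deriv_form k f x)\<bar> \<le> e / 2" if "0 < r" "r < d" for r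
  proof -
    \<comment> \<open>The Taylor polynomial in the rescaled variable has degree below
      \<open>k\<close>, so the oscillation ignores it; \<open>G\<close> is the remainder divided by
      \<open>r ^ k\<close>.\<close>
    define q where "q y = (\<Sum>m<k. deriv_form m f x (replicate m (r *\<^sub>R y)) / fact m)" for y
    define G where "G y = (f (x + r *\<^sub>R y) - q y) / r ^ k" for y
    have "(\<lambda>y. (1 / fact m) * deriv_form m f x (replicate m (r *\<^sub>R y))) \<in> polys_below k"
      if "m < k" for m
      using polys_below_affine[OF deriv_form_diag_in_polys_below[of m f x], of 0 r]
        polys_below_mono[of "Suc m" k] that
      by (intro polys_below_scale) auto
    then have q: "q \<in> polys_below k"
      using polys_below_sum[of "{..<k}" "\<lambda>m y. (1 / fact m) * deriv_form m f x (replicate m (r *\<^sub>R y))" k]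
      by (simp add: q_def[abs_def])
    have fr: "continuous_on UNIV (\<lambda>y. f (x + r *\<^sub>R y))"
      by (rule continuous_on_compose2[OF cont]) (auto intro!: continuous_intros)
    have "osc k f x r = unit_osc k (\<lambda>y. q y + r ^ k * G y)"
      using osc_eq_unit_osc[OF cont \<open>k \<ge> 1\<close> \<open>0 < r\<close>] \<open>0 < r\<close> by (simp add: G_def)
    also have "\<dots> = r ^ k * unit_osc k G"
      using q \<open>0 < r\<close> by (simp add: unit_osc_affine)
    finally have "osc k f x r / r ^ k = unit_osc k G"
      using \<open>0 < r\<close> by simp
    moreover have "\<bar>unit_osc k G - unit_osc k ?D\<bar> \<le> e / 2"
    proof (rule unit_osc_perturb)
      show "continuous_on UNIV G"
        unfolding G_def using \<open>0 < r\<close>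
        by (intro continuous_intros fr polys_below_continuous[OF q]) auto
      fix y :: "real ^ 'n" assume y: "norm y < 1"
      obtain \<theta> where \<theta>: "0 < \<theta>" "\<theta> \<le> 1"
        "f (x + r *\<^sub>R y) = q y + form_poly k (deriv_form k f (x + \<theta> *\<^sub>R r *\<^sub>R y)) (r *\<^sub>R y)"
        unfolding q_def using Taylor_Ck[OF f] .
      \<comment> \<open>The remainder is homogeneous of degree \<open>k\<close> in the direction
        once the intermediate point is fixed, so \<open>r ^ k\<close> cancels.\<close>
      have "G y = form_poly k (deriv_form k f (x + \<theta> *\<^sub>R r *\<^sub>R y)) y"
        using \<open>0 < r\<close> by (simp add: G_def \<theta>(3) form_poly_def deriv_form_diag_scale)
      then have "\<bar>G y - ?D y\<bar> \<le> \<omega> (x + \<theta> *\<^sub>R r *\<^sub>R y)"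
        using form_poly_deriv_form_diff_le[of y k f] y by (simp add: \<omega>_def)
      \<comment> \<open>The intermediate point lies within \<open>d\<close> of \<open>x\<close>,
        whatever \<theta> is.\<close>
      moreover have "\<theta> * (r * norm y) < d"
      proof -
        have "r * norm y < d"
          using y \<open>0 < r\<close> \<open>r < d\<close> by (smt (verit) mult_left_le)
        moreover have "\<theta> * (r * norm y) \<le> r * norm y"
          using \<theta> \<open>0 < r\<close> by (intro mult_left_le_one_le) auto
        ultimately show ?thesis by linarith
      qed
      then have "\<omega> (x + \<theta> *\<^sub>R r *\<^sub>R y) < e / 2"
        using \<theta> \<open>0 < r\<close> by (intro d) (simp add: dist_norm)
      ultimately show "\<bar>G y - ?D y\<bar> \<le> e / 2"
        by linarith
    qed (rule D)
    ultimately show ?thesis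
      by (simp add: osc_const_eq_unit_osc[OF D \<open>k \<ge> 1\<close>])
  qed
  then show "\<forall>\<^sub>F r in at_right 0. dist (osc k f x r / r ^ k) (osc_const k (deriv_form k f x)) < e"
    unfolding dist_real_def using \<open>d > 0\<close> \<open>e > 0\<close>
    by (intro eventually_at_rightI[of 0 d]) fastforce+
qed

theorem theorem3p16:
  fixes k :: nat
  assumes "k \<ge> 1"
  shows "(\<forall>f \<in> (Ck_compact_support k :: (real ^ 'n \<Rightarrow> real) set). \<forall>x.
            ((\<lambda>r. osc k f x r / r ^ k) \<longlongrightarrow> osc_const k (deriv_form k f x)) (at_right 0)) \<and>
         (\<exists>a b. 0 < a \<and> a \<le> b \<and>
            (\<forall>A \<in> (sym_forms k :: ((real ^ 'n) list \<Rightarrow> real) set).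
               a * form_norm k A \<le> osc_const k A \<and> osc_const k A \<le> b * form_norm k A))"
proof (intro conjI)
  show "\<forall>f \<in> (Ck_compact_support k :: (real ^ 'n \<Rightarrow> real) set). \<forall>x.
      ((\<lambda>r. osc k f x r / r ^ k) \<longlongrightarrow> osc_const k (deriv_form k f x)) (at_right 0)"
    using assms by (auto simp: Ck_compact_support_def intro: osc_limit)
  obtain a where a: "a > 0"
    "\<And>A. A \<in> (sym_forms k :: ((real ^ 'n) list \<Rightarrow> real) set) \<Longrightarrow> a * form_norm k A \<le> osc_const k A"
    using osc_const_lower[OF assms] by blast
  \<comment> \<open>The maximum makes \<open>a \<le> b\<close> immediate.\<close>
  define b where "b = max a (real CARD('n) ^ k / fact k)"
  have "osc_const k A \<le> b * form_norm k A" if "A \<in> sym_forms k" for A :: "(real ^ 'n) list \<Rightarrow> real"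
  proof -
    have "0 \<le> form_norm k A"
      by (simp add: form_norm_def sum_nonneg)
    then show ?thesis
      using osc_const_upper[OF that assms] unfolding b_def
      by (meson max.cobounded2 mult_right_mono order_trans)
  qed
  then show "\<exists>a b. 0 < a \<and> a \<le> b \<and>
      (\<forall>A \<in> (sym_forms k :: ((real ^ 'n) list \<Rightarrow> real) set).
        a * form_norm k A \<le> osc_const k A \<and> osc_const k A \<le> b * form_norm k A)"
    using a by (intro exI[of _ a] exI[of _ b]) (auto simp: b_def)
qed

end
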